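(* The following hold. (1) For any finite $2$-group $G$: $\exp(G')=1$ if $|G|\le 2$, and otherwise $\exp(G')\le\frac{|G|}{4}$. (2) For all integers $n\ge 2$ and $0\le k\le n-2$, there exists a $2$-group $G$ of order $2^n$ generated by two elements $x,y\in G$ such that $\operatorname{ord}([x,y])=\exp(G')=2^k$. (3) For any odd prime $p$ and any non-trivial finite $p$-group $G$: $\exp(G')^2<|G|$. (4) For any odd prime $p$ and any integers $n,k\ge 0$ with $k<\frac n2$, there exists a $p$-group $G$ of order $p^n$ generated by two elements $x,y\in G$ such that $\operatorname{ord}([x,y])=\exp(G')=p^k$.
   Context: $G'$ denotes the commutator subgroup of $G$, $\exp(H)$ the exponent of a finite $p$-group $H$ (the greatest order of an element of $H$), $\operatorname{ord}(g)$ the order of an element $g$, and $[x,y]=x^{-1}y^{-1}xy$. *)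

theory Defs
  imports
    "HOL-Algebra.Generated_Groups"
    "HOL-Algebra.Multiplicative_Group"
    "HOL-Computational_Algebra.Primes"
begin

text \<open>For infinite carriers \<^term>\<open>order G\<close> is \<open>0\<close>, so the second conjunct already forces
  the group to be finite when \<open>p\<close> is prime. The trivial group is a \<open>p\<close>-group.\<close>

definition finite_p_group :: "nat \<Rightarrow> ('a, 'b) monoid_scheme \<Rightarrow> bool" where
  "finite_p_group p G \<longleftrightarrow> group G \<and> (\<exists>m. order G = p ^ m)"

text \<open>Meaningful for finite \<open>p\<close>-groups only: in an arbitrary finite group the greatest element
  order may be smaller than the exponent.\<close>

definition group_exponent :: "('a, 'b) monoid_scheme \<Rightarrow> nat" where
  "group_exponent H = Max (group.ord H ` carrier H)"

definition commutator :: "('a, 'b) monoid_scheme \<Rightarrow> 'a \<Rightarrow> 'a \<Rightarrow> 'a" where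
  "commutator G x y = inv\<^bsub>G\<^esub> x \<otimes>\<^bsub>G\<^esub> inv\<^bsub>G\<^esub> y \<otimes>\<^bsub>G\<^esub> x \<otimes>\<^bsub>G\<^esub> y"

definition commutator_subgroup :: "('a, 'b) monoid_scheme \<Rightarrow> ('a, 'b) monoid_scheme" where
  "commutator_subgroup G = G\<lparr>carrier := derived G (carrier G)\<rparr>"

text \<open>The constant \<^const>\<open>derived\<close> is based on the other commutator convention
  \<open>x y x\<^sup>-\<^sup>1 y\<^sup>-\<^sup>1\<close>; the subgroup is the same.\<close>

lemma (in group) derived_eq_generate_commutators:
  "derived G (carrier G) =
     generate G {commutator G x y | x y. x \<in> carrier G \<and> y \<in> carrier G}"
proof -
  have "derived_set G (carrier G) =
      {commutator G x y | x y. x \<in> carrier G \<and> y \<in> carrier G}" (is "?A = ?B")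
  proof (intro equalityI subsetI)
    fix c assume "c \<in> ?A"
    then obtain x y where xy: "x \<in> carrier G" "y \<in> carrier G"
      and c: "c = x \<otimes> y \<otimes> inv x \<otimes> inv y"
      by blast
    have "c = commutator G (inv x) (inv y)"
      using xy by (simp add: c commutator_def)
    then show "c \<in> ?B"
      using xy inv_closed by blast
  next
    fix c assume "c \<in> ?B"
    then obtain x y where xy: "x \<in> carrier G" "y \<in> carrier G" and c: "c = commutator G x y"
      by blast
    have "c = inv x \<otimes> inv y \<otimes> inv (inv x) \<otimes> inv (inv y)"
      using xy by (simp add: c commutator_def)
    then show "c \<in> ?A"
      using xy inv_closed by blast
  qed
  then show ?thesis
    by (simp add: derived_def)
qed

end

theory Submission
  imports Defs "HOL-Algebra.Group_Action" "HOL-Algebra.Elementary_Groups"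
begin

text \<open>
  The upper bounds come from comparing how fast the order of an element \<open>g\<close> of \<open>G'\<close> and the order of
  \<open>G\<close> decrease in quotients of \<open>G\<close>. If \<open>N\<close> is a normal subgroup all of whose elements satisfy
  \<open>x\<^sup>p = 1\<close>, then passing to \<open>G / N\<close> divides the order of \<open>g\<close> by at most \<open>p\<close> (\<open>ord_le_mult_ord_image\<close>), while the order of the group is
  divided by the order of \<open>N\<close>, and the image of \<open>g\<close> still lies in the commutator subgroup.

  For the upper bound with \<open>p = 2\<close>, let \<open>N\<close> be central of order \<open>p\<close>. Both orders decrease by a factor
  \<open>p\<close>, until a group of order \<open>p\<^sup>2\<close> is reached. That group is abelian, so \<open>g\<close> has become trivial; hence
  \<open>ord(g) p\<^sup>2 \<le> |G|\<close> (\<open>nat_p_group_derived_ord_le\<close>). This is true for every prime.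

  For odd \<open>p\<close> one can do better, because a non-cyclic \<open>p\<close>-group then has a normal subgroup \<open>N\<close> of order
  \<open>p\<^sup>2\<close> in which every element satisfies \<open>x\<^sup>p = 1\<close> (\<open>nat_odd_p_group_normal_subgroup\<close>). With this \<open>N\<close>
  the order of the group drops by \<open>p\<^sup>2\<close>, so that \<open>ord(g)\<^sup>2 < |G|\<close> is inherited from \<open>G / N\<close>
  (\<open>nat_odd_p_group_derived_ord_square_less\<close>). The existence of \<open>N\<close> rests on the fact that the \<open>p\<close>-th
  power is a homomorphism on a group with central commutators of order dividing \<open>p\<close>, if \<open>p\<close> is odd
  (\<open>p_power_mult\<close>).

  Every exponent that these bounds leave open occurs in a semidirect product of two cyclic groups, the
  first of order \<open>p ^ (k + 1)\<close>. The second acts as multiplication by a unit \<open>u\<close>, where the greatest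
  common divisor of \<open>u - 1\<close> and \<open>p ^ (k + 1)\<close> is \<open>p\<close>: the commutator of the two generators then
  generates the multiples of \<open>p\<close> in the first factor, and these form the commutator subgroup
  (\<open>ord_commutator_generators\<close>, \<open>derived_pow_eq_one\<close>). Inversion is such a unit for \<open>p = 2\<close>, and
  \<open>1 + p\<close> for odd \<open>p\<close>. The order of \<open>u\<close> has to divide the order of the second factor; it is at most
  \<open>2\<close> in the first case but \<open>p ^ k\<close> in the second, which explains the difference between the two
  bounds.
\<close>

section \<open>Copies and quotients of finite groups\<close>

lemma group_iso_of_inj_on:
  fixes G (structure) and f :: "'a \<Rightarrow> 'c"
  assumes "group G" and inj: "inj_on f (carrier G)"
  obtains H :: "'c monoid" where "group H" "f \<in> iso G H"
proof -
  interpret group G by fact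
  let ?g = "the_inv_into (carrier G) f"
  define H where "H = \<lparr>carrier = f ` carrier G, monoid.mult = (\<lambda>a b. f (?g a \<otimes> ?g b)), one = f \<one>\<rparr>"
  have [simp]: "?g (f x) = x" if "x \<in> carrier G" for x
    using inj that by (rule the_inv_into_f_f)
  have "group H"
  proof (rule groupI)
    fix a assume "a \<in> carrier H"
    then obtain x where x: "x \<in> carrier G" "a = f x"
      by (auto simp: H_def)
    then show "\<exists>b\<in>carrier H. b \<otimes>\<^bsub>H\<^esub> a = \<one>\<^bsub>H\<^esub>"
      by (intro bexI[of _ "f (inv x)"]) (auto simp: H_def)
  qed (auto simp: H_def m_assoc)
  moreover have "f \<in> iso G H"
    using inj by (auto simp: iso_def hom_def bij_betw_def H_def)
  ultimately show ?thesis by (rule that)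
qed

lemma finite_group_iso_nat:
  assumes "group G" "finite (carrier G)"
  obtains H :: "nat monoid" and f where "group H" "f \<in> iso G H"
proof -
  obtain f :: "'a \<Rightarrow> nat" where "inj_on f (carrier G)"
    using finite_imp_inj_to_nat_seg[OF assms(2)] by blast
  then show ?thesis
    by (rule group_iso_of_inj_on[OF assms(1)]) (rule that)
qed

text \<open>Choosing a preimage \<open>s t\<close> of each \<open>t \<in> T\<close> splits the full preimage of \<open>T\<close> into the translates of the
  kernel by the elements \<open>s t\<close>.\<close>

lemma (in group_hom) card_vimage:
  assumes "T \<subseteq> h ` carrier G"
  shows "card {x \<in> carrier G. h x \<in> T} = card (kernel G H h) * card T"
proof -
  define s where "s = inv_into (carrier G) h"
  have s: "s t \<in> carrier G" "h (s t) = t" if "t \<in> T" for t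
    using that assms by (auto simp: s_def inv_into_into f_inv_into_f)
  have t: "t \<in> carrier H" if "t \<in> T" for t
    using that assms by auto
  have "bij_betw (\<lambda>(k, t). k \<otimes> s t) (kernel G H h \<times> T) {x \<in> carrier G. h x \<in> T}"
  proof (rule bij_betwI)
    show "(\<lambda>(k, t). k \<otimes> s t) \<in> kernel G H h \<times> T \<rightarrow> {x \<in> carrier G. h x \<in> T}"
      using s t by (auto simp: kernel_def)
    show "(\<lambda>x. (x \<otimes> inv (s (h x)), h x)) \<in> {x \<in> carrier G. h x \<in> T} \<rightarrow> kernel G H h \<times> T"
      using s t by (auto simp: kernel_def)
    show "(\<lambda>x. (x \<otimes> inv (s (h x)), h x)) (case a of (k, t) \<Rightarrow> k \<otimes> s t) = a"
      if kt: "a \<in> kernel G H h \<times> T" for a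
    proof -
      obtain k u where a: "a = (k, u)" "k \<in> carrier G" "h k = \<one>\<^bsub>H\<^esub>" "u \<in> T"
        using kt by (auto simp: kernel_def)
      have "h (k \<otimes> s u) = u"
        using a s t by simp
      then show ?thesis
        using a s by (simp add: G.m_assoc)
    qed
    show "(case (x \<otimes> inv (s (h x)), h x) of (k, t) \<Rightarrow> k \<otimes> s t) = x"
      if "x \<in> {x \<in> carrier G. h x \<in> T}" for x
      using that s by (simp add: G.m_assoc)
  qed
  then show ?thesis
    by (auto dest!: bij_betw_same_card simp: card_cartesian_product)
qed

lemma (in group_hom) order_eq_card_kernel_mult_card_image:
  "order G = card (kernel G H h) * card (h ` carrier G)"
proof -
  have "{x \<in> carrier G. h x \<in> h ` carrier G} = carrier G"
    by auto
  then show ?thesis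
    using card_vimage[of "h ` carrier G"] by (simp add: order_def)
qed

text \<open>Quotients of a finite group are taken on \<^typ>\<open>nat\<close>: since \<^term>\<open>G Mod N\<close> lives on the type of
  sets over the type of \<^term>\<open>G\<close>, an induction that passes from a group to its quotient can only be
  carried out after the quotient is copied to one fixed type.\<close>

lemma normal_quotient_nat:
  fixes G (structure)
  assumes N: "N \<lhd> G" and fin: "finite (carrier G)"
  obtains Q :: "nat monoid" and q
  where "group_hom G Q q" "q ` carrier G = carrier Q" "kernel G Q q = N"
    "order G = card N * order Q"
proof -
  interpret N: normal N G by fact
  interpret M: group "G Mod N" by (rule N.factorgroup_is_group)
  have "finite (carrier (G Mod N))"
    using fin by (simp add: carrier_FactGroup)
  then obtain Q :: "nat monoid" and f where Q: "group Q" and f: "f \<in> iso (G Mod N) Q"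
    by (rule finite_group_iso_nat[OF M.group_axioms])
  interpret Q: group Q by fact
  define q where "q x = f (N #> x)" for x
  interpret f: group_hom "G Mod N" Q f
    using f by (simp add: group_hom_def group_hom_axioms_def iso_def Q M.group_axioms)
  have q: "group_hom G Q q"
    unfolding q_def group_hom_def group_hom_axioms_def
    using hom_compose[OF N.r_coset_hom_Mod f.homh]
    by (simp add: Q N.is_group comp_def)
  have img: "q ` carrier G = carrier Q"
    using f by (auto simp: q_def iso_def bij_betw_def carrier_FactGroup)
  have ker: "kernel G Q q = N"
  proof -
    have "inj_on f (carrier (G Mod N))"
      using f by (simp add: iso_def bij_betw_def)
    then have "f (N #> x) = \<one>\<^bsub>Q\<^esub> \<longleftrightarrow> N #> x = N" if "x \<in> carrier G" for x
      using that f.hom_one M.one_closed inj_on_eq_iff[of f "carrier (G Mod N)" "N #> x" N]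
      by (simp add: carrier_FactGroup)
    moreover have "N #> x = N \<longleftrightarrow> x \<in> N" if "x \<in> carrier G" for x
      using N.coset_join1[OF _ that N.subgroup_axioms] N.coset_join2[OF that N.subgroup_axioms] by (rule iffI)
    ultimately show ?thesis
      using N.subset by (auto simp: kernel_def q_def)
  qed
  show ?thesis
    using that[OF q img ker] group_hom.order_eq_card_kernel_mult_card_image[OF q] img ker
    by (simp add: order_def)
qed

section \<open>Central subgroups of p-groups\<close>

text \<open>Orbit lengths divide the order of the group. So if no orbit in \<open>A\<close> were a single point, then \<open>p\<close>
  would divide every orbit length, and hence the cardinality of \<open>A\<close>.\<close>

lemma (in group_action) p_group_fixed_point:
  assumes p: "prime p" and ord: "order G = p ^ n"
    and A: "A \<subseteq> E" "finite A" "\<not> p dvd card A"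
    and inv: "\<And>g x. g \<in> carrier G \<Longrightarrow> x \<in> A \<Longrightarrow> \<phi> g x \<in> A"
  obtains x where "x \<in> A" "\<And>g. g \<in> carrier G \<Longrightarrow> \<phi> g x = x"
proof -
  let ?C = "orbit G \<phi> ` A"
  have AE: "x \<in> E" if "x \<in> A" for x
    using that A by blast
  have "\<Union>?C = A"
    using inv orbit_refl[OF AE] by (fastforce simp: orbit_def)
  moreover have "c \<inter> d = {}" if "c \<in> ?C" "d \<in> ?C" "c \<noteq> d" for c d
  proof -
    interpret partition E "orbits G E \<phi>"
      by (rule orbit_partition)
    have "c \<in> orbits G E \<phi>" "d \<in> orbits G E \<phi>"
      using that(1,2) AE by (auto simp: orbits_def)
    then show ?thesis
      using disjoint_union that(3) by blast
  qed
  ultimately obtain x where x: "x \<in> A" "\<not> p dvd card (orbit G \<phi> x)"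
    using A(2,3) dvd_partition[of ?C p] by auto
  have "card (orbit G \<phi> x) dvd p ^ n"
    using orbit_stabilizer_theorem[OF AE[OF x(1)]] ord by (metis dvd_triv_left)
  then obtain i where i: "card (orbit G \<phi> x) = p ^ i"
    using p by (auto simp: divides_primepow_nat)
  then have "i = 0"
    using x(2) by (cases i) auto
  then obtain y where "orbit G \<phi> x = {y}"
    using i by (auto simp: card_1_singleton_iff)
  then have "orbit G \<phi> x = {x}"
    using orbit_refl[OF AE[OF x(1)]] by auto
  then have "\<phi> g x = x" if "g \<in> carrier G" for g
    using that by (auto simp: orbit_def)
  then show ?thesis
    using that x(1) by blast
qed

definition central :: "('a, 'b) monoid_scheme \<Rightarrow> 'a set \<Rightarrow> bool" where
  "central G Z \<longleftrightarrow> (\<forall>z\<in>Z. \<forall>x\<in>carrier G. x \<otimes>\<^bsub>G\<^esub> z = z \<otimes>\<^bsub>G\<^esub> x)"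

context group
begin

lemma central_subgroup_normal:
  assumes "subgroup Z G" "central G Z"
  shows "Z \<lhd> G"
proof (rule normal_invI[OF assms(1)])
  fix x z assume "x \<in> carrier G" "z \<in> Z"
  moreover from this have "x \<otimes> z = z \<otimes> x" "z \<in> carrier G"
    using assms subgroup.mem_carrier[OF assms(1)] by (auto simp: central_def)
  ultimately show "x \<otimes> z \<otimes> inv x \<in> Z"
    by (simp add: m_assoc)
qed

lemma p_group_subgroup_card:
  assumes "prime p" "order G = p ^ n" "subgroup H G"
  obtains k where "card H = p ^ k" "k \<le> n"
proof -
  have "card H dvd p ^ n"
    using lagrange[OF assms(3)] assms(2) by (metis dvd_triv_right)
  then show ?thesis
    using assms(1) that by (auto simp: divides_primepow_nat)
qed

lemma p_group_finite:
  assumes "prime p" "order G = p ^ n"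
  shows "finite (carrier G)"
  using assms by (simp add: order_gt_0_iff_finite[symmetric] prime_gt_0_nat)

lemma p_group_element_of_order_p:
  assumes p: "prime p" and G: "order G = p ^ n" and x: "x \<in> carrier G" "x \<noteq> \<one>"
  obtains m where "ord (x [^] (m::nat)) = p"
proof -
  obtain k where k: "ord x = p ^ k"
    using ord_dvd_group_order[OF x(1)] G p by (auto simp: divides_primepow_nat)
  have "k \<noteq> 0"
    using k x(2) ord_eq_1[OF x(1)] by (intro notI) simp
  then have "ord (x [^] (p ^ (k - 1))) = p"
    using ord_pow[OF x(1), of "p ^ (k - 1)"] k p
    by (simp add: prime_gt_0_nat power_diff_power_eq le_imp_power_dvd)
  then show ?thesis by (rule that)
qed

text \<open>Conjugation permutes \<open>N - {\<one>}\<close>, whose cardinality is \<open>-1\<close> modulo \<open>p\<close>; a fixed point is a central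
  element of \<open>N\<close>, and a suitable power of it has order \<open>p\<close>.\<close>

lemma p_group_central_subgroup_in_normal:
  assumes p: "prime p" and G: "order G = p ^ n" and N: "N \<lhd> G" "N \<noteq> {\<one>}"
  obtains z where "z \<in> N" "ord z = p" "card (generate G {z}) = p" "generate G {z} \<subseteq> N"
    "central G (generate G {z})" "generate G {z} \<lhd> G"
proof -
  interpret N: normal N G by fact
  have fin: "finite (carrier G)"
    using p_group_finite[OF p G] .
  obtain k where k: "card N = p ^ k"
    using p_group_subgroup_card[OF p G N.subgroup_axioms] by blast
  have "card N \<noteq> 1"
    using N(2) N.one_closed unfolding One_nat_def card_1_singleton_iff by blast
  then have "p dvd card N"
    using k by (cases k) auto
  moreover have "card N = card (N - {\<one>}) + 1"
    using card.remove[OF finite_subset[OF N.subset fin] N.one_closed] by simp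
  ultimately have *: "\<not> p dvd card (N - {\<one>})"
    using p by (metis dvd_add_right_iff not_prime_unit)
  interpret C: group_action G "carrier G" "\<lambda>g. \<lambda>h\<in>carrier G. g \<otimes> h \<otimes> inv g"
    by (rule action_by_conjugation)
  have conj: "g \<otimes> x \<otimes> inv g = y \<longleftrightarrow> g \<otimes> x = y \<otimes> g"
    if "g \<in> carrier G" "x \<in> carrier G" "y \<in> carrier G" for g x y
    using that by (metis inv_solve_right m_closed)
  obtain x where x: "x \<in> N - {\<one>}" and
    fixed: "\<And>g. g \<in> carrier G \<Longrightarrow> (\<lambda>h\<in>carrier G. g \<otimes> h \<otimes> inv g) x = x"
  proof (rule C.p_group_fixed_point[OF p G _ _ *])
    show "(\<lambda>h\<in>carrier G. g \<otimes> h \<otimes> inv g) x \<in> N - {\<one>}"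
      if "g \<in> carrier G" "x \<in> N - {\<one>}" for g x
      using that N.inv_op_closed2 conj[of g x \<one>] by auto
  qed (use N.subset fin finite_subset in auto)
  have xG: "x \<in> carrier G" "x \<noteq> \<one>"
    using x by auto
  have xc: "g \<otimes> x = x \<otimes> g" if "g \<in> carrier G" for g
    using fixed[OF that] conj[OF that, of x x] xG by simp
  obtain m where m: "ord (x [^] (m::nat)) = p"
    using p_group_element_of_order_p[OF p G xG] .
  let ?z = "x [^] m"
  have gen: "generate G {?z} = {?z [^] (k::nat) | k. k \<in> UNIV}"
    using m p xG by (intro generate_pow_nat) auto
  have cen: "central G (generate G {?z})"
    unfolding central_def gen using xG xc
    by (auto simp: nat_pow_pow intro!: group_commutes_pow[symmetric])
  have sg: "subgroup (generate G {?z}) G"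
    using xG by (intro generate_is_subgroup) auto
  have zN: "?z \<in> N"
    using x by (induction m) auto
  show ?thesis
  proof (rule that[OF zN m])
    show "card (generate G {?z}) = p"
      using generate_pow_card[of ?z] m xG by simp
    show "generate G {?z} \<subseteq> N"
      using zN by (intro generate_subgroup_incl N.subgroup_axioms) auto
    show "generate G {?z} \<lhd> G"
      by (rule central_subgroup_normal[OF sg cen])
  qed (rule cen)
qed

lemma cyclic_group_of_ord_eq_order:
  assumes "x \<in> carrier G" "ord x = order G" "finite (carrier G)"
  shows "cyclic_group G"
proof -
  have "generate G {x} = carrier G"
    using generate_pow_card[OF assms(1)] assms
    by (intro card_subset_eq generate_incl) (auto simp: order_def)
  then show ?thesis
    using assms(1) cyclic_group generate_pow[OF assms(1)] by (auto simp: full_SetCompr_eq)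
qed

lemma prime_order_cyclic:
  assumes "prime p" "order G = p"
  shows "cyclic_group G"
proof -
  have fin: "finite (carrier G)"
    using p_group_finite[of p 1] assms by simp
  have "card (carrier G) > card {\<one>}"
    using assms prime_gt_1_nat[of p] by (simp add: order_def)
  then have "\<not> carrier G \<subseteq> {\<one>}"
    using card_mono[of "{\<one>}" "carrier G"] by auto
  then obtain x where x: "x \<in> carrier G" "x \<noteq> \<one>"
    by blast
  then have "ord x = p"
    using ord_dvd_group_order[OF x(1)] assms ord_eq_1[OF x(1)] by (auto simp: prime_nat_iff)
  then show ?thesis
    using cyclic_group_of_ord_eq_order x assms(2) fin by simp
qed

lemma subgroup_pow_card:
  assumes "subgroup H G" "y \<in> H"
  shows "y [^] card H = \<one>"
proof -
  interpret H: group "G\<lparr>carrier := H\<rparr>"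
    using assms(1) by (rule subgroup_imp_group)
  have "y [^]\<^bsub>G\<lparr>carrier := H\<rparr>\<^esub> order (G\<lparr>carrier := H\<rparr>) = \<one>"
    using H.pow_order_eq_1[of y] assms(2) by simp
  then show ?thesis
    by (simp add: order_def nat_pow_consistent[symmetric])
qed

text \<open>The usual induction step on the order of a \<open>p\<close>-group. The properties of the kernel allow to carry
  information about \<open>Q\<close> back to \<open>G\<close>.\<close>

lemma p_group_central_quotient:
  assumes p: "prime p" and G: "order G = p ^ Suc n"
  obtains Q :: "nat monoid" and q
  where "group_hom G Q q" "q ` carrier G = carrier Q" "order Q = p ^ n"
    "card (kernel G Q q) = p" "central G (kernel G Q q)"
    "\<And>y. y \<in> kernel G Q q \<Longrightarrow> y [^] p = \<one>"
proof -
  have "order G > 1"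
    unfolding G by (intro one_less_power prime_gt_1_nat[OF p]) simp
  then have "carrier G \<noteq> {\<one>}"
    by (auto simp: order_def)
  then obtain z where z: "card (generate G {z}) = p" "central G (generate G {z})"
    "generate G {z} \<lhd> G"
    using p_group_central_subgroup_in_normal[OF p G normal_self] by blast
  obtain Q :: "nat monoid" and q
    where q: "group_hom G Q q" "q ` carrier G = carrier Q" "kernel G Q q = generate G {z}"
      "order G = card (generate G {z}) * order Q"
    using normal_quotient_nat[OF z(3) p_group_finite[OF p G]] by blast
  show ?thesis
  proof (rule that[OF q(1,2)])
    show "order Q = p ^ n"
      using q(4) z(1) G prime_gt_0_nat[OF p] by simp
    show "y [^] p = \<one>" if "y \<in> kernel G Q q" for y
      using subgroup_pow_card[of "kernel G Q q" y] that z(1) q(3) normal_imp_subgroup[OF z(3)] by simp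
  qed (use z q(3) in auto)
qed

end

section \<open>Orders of elements of the commutator subgroup\<close>

text \<open>How much the order of an element can drop in a quotient: the power of \<open>x\<close> with exponent
  \<open>ord (h x)\<close> lies in the kernel, and the \<open>e\<close>-th power kills the kernel.\<close>

lemma (in group_hom) ord_le_mult_ord_image:
  assumes x: "x \<in> carrier G" "H.ord (h x) > 0"
    and e: "e > 0" "\<And>y. y \<in> kernel G H h \<Longrightarrow> y [^] e = \<one>"
  shows "G.ord x \<le> e * H.ord (h x)"
proof -
  have "x [^] H.ord (h x) \<in> kernel G H h"
    using x by (simp add: kernel_def hom_nat_pow)
  then have "x [^] (H.ord (h x) * e) = \<one>"
    using e(2) x(1) by (simp add: G.nat_pow_pow[symmetric])
  then have "G.ord x dvd H.ord (h x) * e"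
    using G.pow_eq_id x(1) by blast
  then show ?thesis
    using x(2) e(1) by (simp add: dvd_imp_le mult.commute)
qed

text \<open>If \<open>h a\<close> generates \<open>H\<close>, then every element of \<open>G\<close> is a central element times a power of \<open>a\<close>.\<close>

lemma (in group_hom) comm_group_if_cyclic_central_quotient:
  assumes surj: "h ` carrier G = carrier H" and cyc: "cyclic_group H"
    and cen: "central G (kernel G H h)"
  shows "comm_group G"
proof -
  obtain w where w: "w \<in> carrier H" "carrier H = range (\<lambda>n::int. w [^]\<^bsub>H\<^esub> n)"
    using cyc H.cyclic_group by blast
  obtain a where a: "a \<in> carrier G" "h a = w"
    using w(1) surj by (metis imageE)
  \<comment> \<open>Integer exponents, as \<open>H\<close> may be infinite.\<close>
  have decomp: "\<exists>k\<in>kernel G H h. \<exists>n::int. x = k \<otimes> a [^] n" if x: "x \<in> carrier G" for x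
  proof -
    obtain n :: int where n: "h x = w [^]\<^bsub>H\<^esub> n"
      using x w(2) hom_closed[OF x] by auto
    have "h (x \<otimes> inv (a [^] n)) = \<one>\<^bsub>H\<^esub>"
      using x a w(1) n by (simp add: hom_int_pow)
    then have "x \<otimes> inv (a [^] n) \<in> kernel G H h"
      using x a by (simp add: kernel_def)
    moreover have "x = x \<otimes> inv (a [^] n) \<otimes> a [^] n"
      using x a by (simp add: G.m_assoc)
    ultimately show ?thesis by blast
  qed
  show ?thesis
  proof (rule G.group_comm_groupI)
    fix x y assume "x \<in> carrier G" "y \<in> carrier G"
    then obtain k l m n where x: "x = k \<otimes> a [^] (m::int)" and y: "y = l \<otimes> a [^] (n::int)"
      and kl: "k \<in> kernel G H h" "l \<in> kernel G H h"
      using decomp by meson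
    have klG: "k \<in> carrier G" "l \<in> carrier G"
      using kl by (auto simp: kernel_def)
    have kc: "z \<otimes> k = k \<otimes> z" "z \<otimes> l = l \<otimes> z" if "z \<in> carrier G" for z
      using kl that cen by (auto simp: central_def)
    have *: "u \<otimes> a [^] i \<otimes> (v \<otimes> a [^] j) = u \<otimes> v \<otimes> a [^] (i + j)"
      if "u \<in> carrier G" "v \<in> carrier G" "a [^] i \<otimes> v = v \<otimes> a [^] i" for u v and i j :: int
    proof -
      have "u \<otimes> a [^] i \<otimes> (v \<otimes> a [^] j) = u \<otimes> (a [^] i \<otimes> v) \<otimes> a [^] j"
        using that(1,2) a by (simp add: G.m_assoc)
      also have "\<dots> = u \<otimes> v \<otimes> (a [^] i \<otimes> a [^] j)"
        using that a by (simp add: G.m_assoc)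
      finally show ?thesis
        using a by (simp add: G.int_pow_mult)
    qed
    show "x \<otimes> y = y \<otimes> x"
      using klG a kc[of k] kc[of "a [^] m"] kc[of "a [^] n"] by (simp add: x y * kc(2)[of k] add.commute)
  qed
qed

lemma (in group) order_prime_square_comm_group:
  assumes p: "prime p" and G: "order G = p\<^sup>2"
  shows "comm_group G"
proof -
  obtain Q :: "nat monoid" and q
    where q: "group_hom G Q q" "q ` carrier G = carrier Q" "order Q = p ^ 1"
      "central G (kernel G Q q)"
    using p_group_central_quotient[OF p, of 1] G by (metis Suc_1)
  interpret q: group_hom G Q q by fact
  have "cyclic_group Q"
    using q.H.prime_order_cyclic[OF p] q(3) by simp
  then show ?thesis
    using q.comm_group_if_cyclic_central_quotient q(2,4) by simp
qed

lemma (in group_hom) derived_image: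
  assumes "h ` carrier G = carrier H" "x \<in> derived G (carrier G)"
  shows "h x \<in> derived H (carrier H)"
  using derived_img[of "carrier G"] assms by auto

lemma (in group) ord_pos:
  assumes "finite (carrier G)" "x \<in> carrier G"
  shows "ord x > 0"
  using ord_ge_1[OF assms] by simp

text \<open>A quotient by a central subgroup of order \<open>p\<close> divides the order of the group by \<open>p\<close> and the order
  of \<open>g\<close> by at most \<open>p\<close>, so the inequality descends to groups of order \<open>p\<^sup>2\<close>. These are abelian.\<close>

lemma nat_p_group_derived_ord_le:
  fixes G :: "nat monoid"
  assumes "prime p" "group G" "order G = p ^ (n + 2)" "g \<in> derived G (carrier G)"
  shows "group.ord G g * p\<^sup>2 \<le> p ^ (n + 2)"
  using assms(2-)
proof (induction n arbitrary: G g)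
  case 0
  interpret group G by fact
  interpret comm_group G
    using order_prime_square_comm_group[OF assms(1)] 0(2) by (simp add: power2_eq_square)
  have "g = \<one>\<^bsub>G\<^esub>"
    using derived_eq_singleton[of "carrier G"] 0 by simp
  then show ?case
    by (simp add: power2_eq_square)
next
  case (Suc n)
  interpret group G by fact
  have gG: "g \<in> carrier G"
    using derived_in_carrier[of "carrier G"] Suc.prems by auto
  obtain Q :: "nat monoid" and q
    where q: "group_hom G Q q" "q ` carrier G = carrier Q" "order Q = p ^ (n + 2)"
      "\<And>y. y \<in> kernel G Q q \<Longrightarrow> y [^]\<^bsub>G\<^esub> p = \<one>\<^bsub>G\<^esub>"
    using p_group_central_quotient[OF assms(1), of "n + 2"] Suc.prems(2)
    by (metis add_Suc)
  interpret q: group_hom G Q q by fact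
  have "ord g \<le> p * q.H.ord (q g)"
    using q.H.ord_pos[OF q.H.p_group_finite[OF assms(1) q(3)]] gG prime_gt_0_nat[OF assms(1)] q(4)
    by (intro q.ord_le_mult_ord_image) auto
  then have "ord g * p\<^sup>2 \<le> p * (q.H.ord (q g) * p\<^sup>2)"
    using mult_le_mono1 by (simp add: mult.assoc[symmetric])
  also have "\<dots> \<le> p * p ^ (n + 2)"
    using Suc.IH[OF q.H.is_group q(3)] q.derived_image[OF q(2) Suc.prems(3)] mult_le_mono2
    by blast
  finally show ?case
    by simp
qed

section \<open>Normal subgroups of exponent p in odd p-groups\<close>

text \<open>The element \<open>c\<close> is the commutator \<open>[y, x]\<close>. Moving \<open>x\<close> to the left past \<open>y [^] n\<close> costs one factor
  \<open>c\<close> for each of the \<open>n\<close> factors \<open>y\<close>, and \<open>0 + 1 + \<dots> + (n - 1)\<close> is \<open>n choose 2\<close>.\<close>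

lemma (in group) pow_mult_commutator:
  assumes [simp]: "x \<in> carrier G" "y \<in> carrier G" "c \<in> carrier G"
    and yx: "y \<otimes> x = x \<otimes> y \<otimes> c" and c: "\<And>u. u \<in> {x, y} \<Longrightarrow> c \<otimes> u = u \<otimes> c"
  shows "(x \<otimes> y) [^] (n::nat) = x [^] n \<otimes> y [^] n \<otimes> c [^] (n choose 2)"
proof (induction n)
  case (Suc n)
  have cx: "c [^] k \<otimes> x = x \<otimes> c [^] k" and cy: "c [^] k \<otimes> y = y \<otimes> c [^] k" for k :: nat
    using c[of x] c[of y] by (auto intro: group_commutes_pow)
  have yxn: "y [^] k \<otimes> x = x \<otimes> (y [^] k \<otimes> c [^] k)" for k :: nat
  proof (induction k)
    case (Suc k)
    have "y [^] Suc k \<otimes> x = y [^] k \<otimes> (y \<otimes> x)"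
      by (simp add: m_assoc)
    also have "\<dots> = (y [^] k \<otimes> x) \<otimes> (y \<otimes> c)"
      by (simp add: yx m_assoc)
    also have "\<dots> = x \<otimes> y [^] k \<otimes> (c [^] k \<otimes> y) \<otimes> c"
      by (simp add: Suc m_assoc)
    also have "\<dots> = x \<otimes> (y [^] Suc k \<otimes> c [^] Suc k)"
      unfolding cy by (simp add: m_assoc)
    finally show ?case .
  qed simp
  let ?T = "n choose 2"
  have "(x \<otimes> y) [^] Suc n = x [^] n \<otimes> y [^] n \<otimes> (c [^] ?T \<otimes> x) \<otimes> y"
    by (simp add: Suc m_assoc)
  also have "\<dots> = x [^] n \<otimes> (y [^] n \<otimes> x) \<otimes> (c [^] ?T \<otimes> y)"
    unfolding cx by (simp add: m_assoc)
  also have "\<dots> = x [^] Suc n \<otimes> y [^] n \<otimes> (c [^] n \<otimes> y) \<otimes> c [^] ?T"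
    unfolding yxn cy[of ?T] by (simp add: m_assoc)
  also have "\<dots> = x [^] Suc n \<otimes> y [^] Suc n \<otimes> (c [^] n \<otimes> c [^] ?T)"
    unfolding cy by (simp add: m_assoc)
  also have "c [^] n \<otimes> c [^] ?T = c [^] (Suc n choose 2)"
    by (simp add: nat_pow_mult numeral_2_eq_2)
  finally show ?case .
qed (simp add: numeral_2_eq_2)

context group_hom begin

lemma vimage_normal:
  assumes "N \<lhd> H"
  shows "{x \<in> carrier G. h x \<in> N} \<lhd> G"
proof -
  interpret N: normal N H by fact
  show ?thesis
  proof (rule G.normal_invI)
    show "subgroup {x \<in> carrier G. h x \<in> N} G"
      by (rule G.subgroupI) auto
    show "x \<otimes> y \<otimes> inv x \<in> {x \<in> carrier G. h x \<in> N}"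
      if "x \<in> carrier G" "y \<in> {x \<in> carrier G. h x \<in> N}" for x y
      using that N.inv_op_closed2 by simp
  qed
qed

end

context group begin

text \<open>Take a central subgroup \<open>Z\<close> of order \<open>p\<close> inside \<open>K\<close>, then a central subgroup of order \<open>p\<close> of \<open>G / Z\<close>
  inside \<open>K / Z\<close>; the preimage of the latter is \<open>M\<close>.\<close>

lemma p_group_normal_subgroup_of_order_square:
  assumes p: "prime p" and G: "order G = p ^ n" and K: "K \<lhd> G" "card K > p"
  obtains M where "M \<lhd> G" "card M = p\<^sup>2" "M \<subseteq> K"
proof -
  interpret K: normal K G by fact
  note fin = p_group_finite[OF p G]
  have "K \<noteq> {\<one>}"
    using K(2) prime_gt_0_nat[OF p] by auto
  then obtain z where z: "generate G {z} \<subseteq> K" "card (generate G {z}) = p" "generate G {z} \<lhd> G"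
    using p_group_central_subgroup_in_normal[OF p G K(1)] by metis
  obtain Q :: "nat monoid" and q
    where q: "group_hom G Q q" "q ` carrier G = carrier Q" "kernel G Q q = generate G {z}"
      "order G = card (generate G {z}) * order Q"
    using normal_quotient_nat[OF z(3) fin] by blast
  interpret q: group_hom G Q q by fact
  have "order Q dvd p ^ n"
    using q(4) G by (metis dvd_triv_right)
  then obtain m where m: "order Q = p ^ m"
    using p by (auto simp: divides_primepow_nat)
  have qK: "q ` K \<lhd> Q"
    using K.surj_hom_normal_subgroup[OF q(1,2)] .
  have "q ` K \<noteq> {\<one>\<^bsub>Q\<^esub>}"
  proof
    assume "q ` K = {\<one>\<^bsub>Q\<^esub>}"
    then have "K \<subseteq> generate G {z}"
      using K.subset unfolding q(3)[symmetric] kernel_def by auto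
    moreover have "finite (generate G {z})"
      using z(2) prime_gt_0_nat[OF p] card_gt_0_iff by metis
    ultimately show False
      using z(2) K(2) card_mono by (metis leD)
  qed
  then obtain w where w: "generate Q {w} \<subseteq> q ` K" "card (generate Q {w}) = p"
    "generate Q {w} \<lhd> Q"
    using q.H.p_group_central_subgroup_in_normal[OF p m qK] by metis
  define M where "M = {x \<in> carrier G. q x \<in> generate Q {w}}"
  \<comment> \<open>\<open>K\<close> contains the kernel of \<open>q\<close>, so it is the full preimage of its image.\<close>
  have "M \<subseteq> K"
  proof
    fix x assume "x \<in> M"
    then have x: "x \<in> carrier G" "q x \<in> q ` K"
      using w(1) by (auto simp: M_def)
    then obtain k where k: "k \<in> K" "q x = q k"
      by blast
    then have kG: "k \<in> carrier G"
      by simp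
    have "x \<otimes> inv k \<in> kernel G Q q"
      using x k kG by (simp add: kernel_def)
    then have "x \<otimes> inv k \<in> K"
      using q(3) z(1) by blast
    then have "x \<otimes> inv k \<otimes> k \<in> K"
      using k(1) by simp
    then show "x \<in> K"
      using x(1) kG by (simp add: m_assoc)
  qed
  moreover have "generate Q {w} \<subseteq> q ` carrier G"
    using w(1) K.subset by blast
  then have "card M = p\<^sup>2"
    using q.card_vimage[of "generate Q {w}"] w(1,2) q(3) z(2) K.subset
    by (auto simp: M_def power2_eq_square)
  moreover have "M \<lhd> G"
    unfolding M_def by (rule q.vimage_normal[OF w(3)])
  ultimately show ?thesis
    using that by blast
qed

text \<open>This is where \<open>p\<close> must be odd: then \<open>p\<close> divides \<open>p choose 2\<close>, and the commutator factor in
  \<open>pow_mult_commutator\<close> vanishes. In the quaternion group of order \<open>8\<close>, squaring is not a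
  homomorphism.\<close>

lemma p_power_mult:
  fixes p :: nat
  assumes "odd p" "x \<in> carrier G" "y \<in> carrier G" "c \<in> carrier G"
    and "y \<otimes> x = x \<otimes> y \<otimes> c" "\<And>u. u \<in> {x, y} \<Longrightarrow> c \<otimes> u = u \<otimes> c" "c [^] p = \<one>"
  shows "(x \<otimes> y) [^] p = x [^] p \<otimes> y [^] p"
proof -
  have "p choose 2 = p * ((p - 1) div 2)"
    using assms(1) by (auto simp: choose_two elim!: oddE)
  then have "c [^] (p choose 2) = \<one>"
    using assms(4,7) by (simp add: nat_pow_pow[symmetric])
  then show ?thesis
    using pow_mult_commutator[OF assms(2-6), of p] assms(2,3) by simp
qed

text \<open>On such an \<open>N\<close> the \<open>p\<close>-th power is a homomorphism into \<open>Z\<close>. Its kernel is therefore a subgroup of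
  index at most \<open>p\<close> in \<open>N\<close>; it is normal in \<open>G\<close> because powers commute with conjugation.\<close>

lemma normal_p_torsion_of_central_extension:
  assumes p: "odd p" and N: "N \<lhd> G" and Z: "subgroup Z G" "central G Z" "card Z = p"
    and pow: "\<And>x. x \<in> N \<Longrightarrow> x [^] p \<in> Z"
    and comm: "\<And>x y. x \<in> N \<Longrightarrow> y \<in> N \<Longrightarrow> \<exists>c\<in>Z. y \<otimes> x = x \<otimes> y \<otimes> c"
  shows "{x \<in> N. x [^] p = \<one>} \<lhd> G" "card N \<le> p * card {x \<in> N. x [^] p = \<one>}"
proof -
  interpret N: normal N G by fact
  interpret Z: subgroup Z G by fact
  have mult: "(x \<otimes> y) [^] p = x [^] p \<otimes> y [^] p" if xy: "x \<in> N" "y \<in> N" for x y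
  proof -
    obtain c where c: "c \<in> Z" "y \<otimes> x = x \<otimes> y \<otimes> c"
      using comm xy by blast
    then show ?thesis
      using xy Z(2) subgroup_pow_card[OF Z(1) c(1)] Z(3)
      by (intro p_power_mult[OF p]) (auto simp: central_def)
  qed
  have conj: "(x \<otimes> y \<otimes> inv x) [^] k = x \<otimes> y [^] k \<otimes> inv x"
    if [simp]: "x \<in> carrier G" "y \<in> carrier G" for x y and k :: nat
  proof (induction k)
    case (Suc k)
    have cancel: "inv x \<otimes> (x \<otimes> u) = u" if "u \<in> carrier G" for u
      using that by (simp add: m_assoc[symmetric])
    have "(x \<otimes> y \<otimes> inv x) [^] Suc k = x \<otimes> y [^] k \<otimes> (inv x \<otimes> x) \<otimes> y \<otimes> inv x"
      unfolding nat_pow_Suc Suc by (simp add: m_assoc cancel)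
    then show ?case
      by (simp add: m_assoc)
  qed simp
  have pow_hom: "group_hom (G\<lparr>carrier := N\<rparr>) (G\<lparr>carrier := Z\<rparr>) (\<lambda>x. x [^] p)"
    using N.subgroup_is_group[OF is_group] Z.subgroup_is_group[OF is_group] pow mult
    by (auto simp: group_hom_def group_hom_axioms_def hom_def)
  then interpret P: group_hom "G\<lparr>carrier := N\<rparr>" "G\<lparr>carrier := Z\<rparr>" "\<lambda>x. x [^] p" .
  have ker: "kernel (G\<lparr>carrier := N\<rparr>) (G\<lparr>carrier := Z\<rparr>) (\<lambda>x. x [^] p) = {x \<in> N. x [^] p = \<one>}"
    by (auto simp: kernel_def)
  show "{x \<in> N. x [^] p = \<one>} \<lhd> G"
  proof (rule normal_invI)
    show "subgroup {x \<in> N. x [^] p = \<one>} G"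
      using P.subgroup_kernel unfolding ker
      by (rule incl_subgroup[OF N.subgroup_axioms])
    show "x \<otimes> y \<otimes> inv x \<in> {x \<in> N. x [^] p = \<one>}"
      if "x \<in> carrier G" "y \<in> {x \<in> N. x [^] p = \<one>}" for x y
      using that N.inv_op_closed2 by (simp add: conj)
  qed
  have "finite Z"
    using Z(3) p by (metis card.infinite even_zero)
  have card_img: "card ((\<lambda>x. x [^] p) ` N) \<le> p"
    using card_mono[OF \<open>finite Z\<close>, of "(\<lambda>x. x [^] p) ` N"] pow Z(3) by blast
  have "card N = card {x \<in> N. x [^] p = \<one>} * card ((\<lambda>x. x [^] p) ` N)"
    using P.order_eq_card_kernel_mult_card_image by (simp add: order_def ker)
  also have "\<dots> \<le> card {x \<in> N. x [^] p = \<one>} * p"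
    using card_img by (rule mult_le_mono2)
  finally show "card N \<le> p * card {x \<in> N. x [^] p = \<one>}"
    by (simp only: mult.commute)
qed

end

lemma (in comm_group) p_torsion_normal:
  "{x \<in> carrier G. x [^] (p::nat) = \<one>} \<lhd> G"
proof (rule subgroup_imp_normal)
  show "subgroup {x \<in> carrier G. x [^] p = \<one>} G"
    by (rule subgroupI) (auto simp: nat_pow_distrib nat_pow_inv)
qed

text \<open>A cyclic quotient \<open>Q\<close> of \<open>G\<close> by a central subgroup \<open>Z\<close> of order \<open>p\<close> forces \<open>G\<close> to be abelian, so
  that the elements killed by \<open>p\<close> form a subgroup containing \<open>Z\<close>. It is larger than \<open>Z\<close>: if \<open>x\<close> maps to a
  generator of \<open>Q\<close>, then \<open>x\<close> has order at most \<open>p ^ n\<close>, as \<open>G\<close> is not cyclic, and its power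
  with exponent \<open>p ^ (n - 1)\<close> is killed by \<open>p\<close> without lying in \<open>Z\<close>.\<close>

lemma (in group) abelian_p_group_normal_p_torsion:
  assumes p: "prime p" and G: "order G = p ^ Suc n" and ncyc: "\<not> cyclic_group G"
    and q: "group_hom G Q q" "q ` carrier G = carrier Q" "order Q = p ^ n"
      "card (kernel G Q q) = p" "central G (kernel G Q q)"
      "\<And>y. y \<in> kernel G Q q \<Longrightarrow> y [^] p = \<one>"
    and cyc: "cyclic_group Q"
  obtains K where "K \<lhd> G" "card K > p" "\<And>x. x \<in> K \<Longrightarrow> x [^] p = \<one>"
proof -
  interpret q: group_hom G Q q by fact
  interpret comm_group G
    using q.comm_group_if_cyclic_central_quotient[OF q(2) cyc q(5)] .
  let ?K = "{x \<in> carrier G. x [^] p = \<one>}"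
  note fin = p_group_finite[OF p G]
  have "n \<noteq> 0"
    using prime_order_cyclic[OF p] G ncyc by (intro notI) simp
  then obtain m where m: "n = Suc m"
    using not0_implies_Suc by blast
  obtain w where w: "w \<in> carrier Q" "q.H.ord w = p ^ n"
  proof -
    obtain w where "w \<in> carrier Q" "carrier Q = range (\<lambda>n::int. w [^]\<^bsub>Q\<^esub> n)"
      using cyc q.H.cyclic_group by blast
    then show ?thesis
      using that q.H.generate_pow_card[of w] q.H.generate_pow[of w] q(3)
      by (simp add: order_def full_SetCompr_eq)
  qed
  then obtain x where x: "x \<in> carrier G" "q x = w"
    using q(2) by (metis imageE)
  have "x [^] (p ^ n) = \<one>"
  proof (rule ccontr)
    assume *: "x [^] (p ^ n) \<noteq> \<one>"
    obtain i where i: "ord x = p ^ i" "i \<le> Suc n"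
      using ord_dvd_group_order[OF x(1)] G p divides_primepow_nat by metis
    have "\<not> p ^ i dvd p ^ n"
      using * pow_eq_id[OF x(1)] i(1) by simp
    then have "i = Suc n"
      using i(2) le_imp_power_dvd[of i n p] by (cases "i \<le> n") auto
    then show False
      using cyclic_group_of_ord_eq_order[OF x(1) _ fin] i(1) G ncyc by simp
  qed
  then have y: "x [^] (p ^ m) \<in> ?K"
    using x(1) m by (simp add: nat_pow_pow mult.commute)
  have "x [^] (p ^ m) \<notin> kernel G Q q"
  proof
    assume "x [^] (p ^ m) \<in> kernel G Q q"
    then have "w [^]\<^bsub>Q\<^esub> (p ^ m) = \<one>\<^bsub>Q\<^esub>"
      using x by (simp add: kernel_def q.hom_nat_pow)
    then have "p ^ n dvd p ^ m"
      using q.H.pow_eq_id[OF w(1)] w(2) by simp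
    then show False
      using m p prime_gt_1_nat[OF p] by (auto dest: dvd_imp_le simp: prime_gt_0_nat)
  qed
  moreover have "kernel G Q q \<subseteq> ?K"
    using q(6) by (auto simp: kernel_def)
  ultimately have "kernel G Q q \<subset> ?K"
    using y by blast
  then have card: "card ?K > p"
    using psubset_card_mono[of ?K "kernel G Q q"] fin q(4) by simp
  show ?thesis
    by (rule that[OF p_torsion_normal card]) simp
qed

text \<open>For odd \<open>p\<close>, a non-cyclic \<open>p\<close>-group has a normal subgroup of type \<open>C\<^sub>p \<times> C\<^sub>p\<close>. It is enough to find a
  normal subgroup \<open>K\<close> of exponent \<open>p\<close> and order greater than \<open>p\<close>. Let \<open>Q\<close> be the quotient by a central
  subgroup \<open>Z\<close> of order \<open>p\<close>. If \<open>Q\<close> is not cyclic, the induction hypothesis gives a subgroup of \<open>Q\<close>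
  whose preimage \<open>N\<close> has order \<open>p\<^sup>3\<close>, and the \<open>p\<close>-th power maps \<open>N\<close> homomorphically to \<open>Z\<close>, with a
  kernel of order at least \<open>p\<^sup>2\<close>. For \<open>p = 2\<close> the statement fails: the quaternion group of order \<open>8\<close>
  has only one element of order \<open>2\<close>.\<close>

lemma nat_odd_p_group_normal_subgroup:
  fixes G :: "nat monoid"
  assumes p: "prime p" "odd p"
  assumes "group G" "order G = p ^ n" "\<not> cyclic_group G"
  shows "\<exists>N. N \<lhd> G \<and> card N = p\<^sup>2 \<and> (\<forall>x\<in>N. x [^]\<^bsub>G\<^esub> p = \<one>\<^bsub>G\<^esub>)"
  using assms(3-)
proof (induction n arbitrary: G)
  case 0
  interpret group G by fact
  have "cyclic_group G"
    using cyclic_group_of_ord_eq_order[OF one_closed] p_group_finite[OF p(1) 0(2)] 0(2) by simp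
  then show ?case
    using 0(3) by blast
next
  case (Suc n)
  interpret group G by fact
  obtain Q :: "nat monoid" and q
    where q: "group_hom G Q q" "q ` carrier G = carrier Q" "order Q = p ^ n"
      "card (kernel G Q q) = p" "central G (kernel G Q q)"
      "\<And>y. y \<in> kernel G Q q \<Longrightarrow> y [^]\<^bsub>G\<^esub> p = \<one>\<^bsub>G\<^esub>"
    using p_group_central_quotient[OF p(1) Suc.prems(2)] by blast
  interpret q: group_hom G Q q by fact
  have "\<exists>K. K \<lhd> G \<and> card K > p \<and> (\<forall>x\<in>K. x [^]\<^bsub>G\<^esub> p = \<one>\<^bsub>G\<^esub>)"
  proof (cases "cyclic_group Q")
    case True
    then show ?thesis
      using abelian_p_group_normal_p_torsion[OF p(1) Suc.prems(2,3) q] by metis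
  next
    case False
    then obtain M where M: "M \<lhd> Q" "card M = p\<^sup>2" "\<And>x. x \<in> M \<Longrightarrow> x [^]\<^bsub>Q\<^esub> p = \<one>\<^bsub>Q\<^esub>"
      using Suc.IH[OF q.H.is_group q(3)] by blast
    interpret M: normal M Q by fact
    interpret M': comm_group "Q\<lparr>carrier := M\<rparr>"
      using group.order_prime_square_comm_group[OF M.subgroup_is_group[OF q.H.is_group] p(1)] M(2)
      by (simp add: order_def)
    define N where "N = {x \<in> carrier G. q x \<in> M}"
    have N: "N \<lhd> G"
      unfolding N_def by (rule q.vimage_normal[OF M(1)])
    have cardN: "card N = p * p\<^sup>2"
      unfolding N_def using q.card_vimage[of M] M.subset M(2) q(2,4) by simp
    let ?K = "{x \<in> N. x [^]\<^bsub>G\<^esub> p = \<one>\<^bsub>G\<^esub>}"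
    have K: "?K \<lhd> G" "card N \<le> p * card ?K"
    proof -
      have pw: "x [^]\<^bsub>G\<^esub> p \<in> kernel G Q q" if "x \<in> N" for x
        using that M(3) by (simp add: N_def kernel_def q.hom_nat_pow)
      have cm: "\<exists>c\<in>kernel G Q q. y \<otimes>\<^bsub>G\<^esub> x = x \<otimes>\<^bsub>G\<^esub> y \<otimes>\<^bsub>G\<^esub> c"
        if "x \<in> N" "y \<in> N" for x y
      proof
        have xy: "x \<in> carrier G" "y \<in> carrier G" "q x \<otimes>\<^bsub>Q\<^esub> q y = q y \<otimes>\<^bsub>Q\<^esub> q x"
          using that M'.m_comm by (auto simp: N_def)
        let ?c = "inv\<^bsub>G\<^esub> (x \<otimes>\<^bsub>G\<^esub> y) \<otimes>\<^bsub>G\<^esub> (y \<otimes>\<^bsub>G\<^esub> x)"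
        show "y \<otimes>\<^bsub>G\<^esub> x = x \<otimes>\<^bsub>G\<^esub> y \<otimes>\<^bsub>G\<^esub> ?c"
          using xy(1,2) by (simp add: m_assoc[symmetric] del: inv_mult_group)
        show "?c \<in> kernel G Q q"
          using xy by (simp add: kernel_def del: inv_mult_group)
      qed
      show "?K \<lhd> G" "card N \<le> p * card ?K"
        using normal_p_torsion_of_central_extension[OF p(2) N q.subgroup_kernel q(5,4) pw cm] by blast+
    qed
    have "p < p\<^sup>2"
      using prime_gt_1_nat[OF p(1)] by (simp add: power2_eq_square)
    also have "p\<^sup>2 \<le> card ?K"
      using K(2) cardN prime_gt_0_nat[OF p(1)] by simp
    finally have "p < card ?K" .
    then show ?thesis
      using K(1) by blast
  qed
  then obtain K where K: "K \<lhd> G" "card K > p" "\<And>x. x \<in> K \<Longrightarrow> x [^]\<^bsub>G\<^esub> p = \<one>\<^bsub>G\<^esub>"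
    by blast
  obtain N where N: "N \<lhd> G" "card N = p\<^sup>2" "N \<subseteq> K"
    using p_group_normal_subgroup_of_order_square[OF p(1) Suc.prems(2) K(1,2)] .
  then show ?case
    using K(3) by blast
qed

text \<open>Dividing by a normal subgroup of type \<open>C\<^sub>p \<times> C\<^sub>p\<close> divides the order of the group by \<open>p\<^sup>2\<close>, but the order
  of \<open>g\<close> by at most \<open>p\<close>. The descent stops at abelian groups, where \<open>g\<close> is trivial.\<close>

lemma nat_odd_p_group_derived_ord_square_less:
  fixes G :: "nat monoid"
  assumes p: "prime p" "odd p"
    and "group G" "order G = p ^ n" "n > 0" "g \<in> derived G (carrier G)"
  shows "(group.ord G g)\<^sup>2 < p ^ n"
  using assms(3-)
proof (induction n arbitrary: G g rule: less_induct)
  case (less n)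
  interpret group G by (rule less.prems)
  have gG: "g \<in> carrier G"
    using derived_in_carrier[of "carrier G"] less.prems by auto
  have p1: "p > 1" "p > 0"
    using prime_gt_1_nat[OF p(1)] by auto
  show ?case
  proof (cases "cyclic_group G")
    case True
    interpret comm_group G
      using True by (rule cyclic_imp_abelian_group)
    have "g = \<one>\<^bsub>G\<^esub>"
      using derived_eq_singleton[of "carrier G"] less.prems by simp
    then show ?thesis
      using one_less_power[OF p1(1)] less.prems by simp
  next
    case False
    then obtain N where N: "N \<lhd> G" "card N = p\<^sup>2" "\<And>x. x \<in> N \<Longrightarrow> x [^]\<^bsub>G\<^esub> p = \<one>\<^bsub>G\<^esub>"
      using nat_odd_p_group_normal_subgroup[OF p] less.prems by blast
    obtain k where "card N = p ^ k" "k \<le> n"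
      using p_group_subgroup_card[OF p(1) less.prems(2) normal_imp_subgroup[OF N(1)]] .
    then have "n \<ge> 2"
      using N(2) p1 by simp
    show ?thesis
    \<comment> \<open>For \<open>n = 2\<close> the quotient is trivial, and the strict inequality fails for it.\<close>
    proof (cases "n = 2")
      case True
      interpret comm_group G
        using order_prime_square_comm_group[OF p(1)] less.prems(2) True by simp
      have "g = \<one>\<^bsub>G\<^esub>"
        using derived_eq_singleton[of "carrier G"] less.prems by simp
      then show ?thesis
        using one_less_power[OF p1(1)] less.prems by simp
    next
      case False
      define m where "m = n - 2"
      have m: "n = m + 2" "m > 0"
        using False \<open>n \<ge> 2\<close> by (auto simp: m_def)
      obtain Q :: "nat monoid" and q
        where q: "group_hom G Q q" "q ` carrier G = carrier Q" "kernel G Q q = N"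
          "order G = card N * order Q"
        using normal_quotient_nat[OF N(1) p_group_finite[OF p(1) less.prems(2)]] .
      interpret q: group_hom G Q q by fact
      have Q: "order Q = p ^ m"
        using q(4) N(2) less.prems(2) p1 by (simp add: m power_add power2_eq_square)
      have "ord g \<le> p * q.H.ord (q g)"
        using q.H.ord_pos[OF q.H.p_group_finite[OF p(1) Q]] gG p1 N(3) q(3)
        by (intro q.ord_le_mult_ord_image) auto
      then have "(ord g)\<^sup>2 \<le> p\<^sup>2 * (q.H.ord (q g))\<^sup>2"
        using power_mono[of "ord g" "p * q.H.ord (q g)" 2] by (simp add: power_mult_distrib)
      also have "\<dots> < p\<^sup>2 * p ^ m"
        using less.IH[OF _ q.H.is_group Q m(2) q.derived_image[OF q(2) less.prems(4)]] m p1 by simp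
      finally show ?thesis
        by (simp add: m power_add power2_eq_square mult_ac)
    qed
  qed
qed

section \<open>The exponent of the commutator subgroup\<close>

lemma (in group) group_exponent_commutator_subgroup:
  "group_exponent (commutator_subgroup G) = Max (ord ` derived G (carrier G))"
proof -
  have D: "subgroup (derived G (carrier G)) G"
    by (rule derived_is_subgroup) auto
  interpret D: group "G\<lparr>carrier := derived G (carrier G)\<rparr>"
    by (rule subgroup_imp_group[OF D])
  have "D.ord = ord"
    by (simp add: fun_eq_iff D.ord_def ord_def nat_pow_consistent[symmetric])
  then show ?thesis
    by (simp add: group_exponent_def commutator_subgroup_def)
qed

lemma (in group) group_exponent_commutator_subgroup_attained:
  assumes "finite (carrier G)"
  obtains g where "g \<in> derived G (carrier G)" "group_exponent (commutator_subgroup G) = ord g"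
proof -
  have "finite (derived G (carrier G))"
    using derived_in_carrier[of "carrier G"] assms finite_subset by blast
  moreover have "\<one> \<in> derived G (carrier G)"
    using subgroup.one_closed[OF derived_is_subgroup[of "carrier G"]] by simp
  ultimately have "Max (ord ` derived G (carrier G)) \<in> ord ` derived G (carrier G)"
    by (intro Max_in) auto
  then show ?thesis
    using that by (auto simp: group_exponent_commutator_subgroup)
qed

lemma iso_ord:
  assumes "group G" "group H" "f \<in> iso G H" "x \<in> carrier G"
  shows "group.ord H (f x) = group.ord G x"
proof -
  interpret f: group_hom G H f
    using assms by (simp add: group_hom_def group_hom_axioms_def iso_def)
  have "inj_on f (carrier G)"
    using assms(3) by (simp add: iso_def bij_betw_def)
  then have "f x [^]\<^bsub>H\<^esub> n = \<one>\<^bsub>H\<^esub> \<longleftrightarrow> x [^]\<^bsub>G\<^esub> n = \<one>\<^bsub>G\<^esub>" for n :: nat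
    using inj_on_eq_iff[of f "carrier G" "x [^]\<^bsub>G\<^esub> n" "\<one>\<^bsub>G\<^esub>"] assms(4) f.hom_nat_pow[of x n]
    by simp
  then show ?thesis
    using f.H.ord_unique[of "f x" "f.G.ord x"] f.G.pow_eq_id[OF assms(4)] assms(4) by simp
qed

lemma iso_group_exponent_commutator_subgroup:
  assumes "group G" "group H" "f \<in> iso G H"
  shows "group_exponent (commutator_subgroup H) = group_exponent (commutator_subgroup G)"
proof -
  interpret f: group_hom G H f
    using assms by (simp add: group_hom_def group_hom_axioms_def iso_def)
  have "f ` carrier G = carrier H"
    using assms(3) by (simp add: iso_def bij_betw_def)
  then have "derived H (carrier H) = f ` derived G (carrier G)"
    using f.derived_img[of "carrier G"] by simp
  moreover have "group.ord H (f x) = group.ord G x" if "x \<in> derived G (carrier G)" for x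
    using iso_ord[OF assms] f.G.derived_in_carrier[of "carrier G"] that by blast
  ultimately show ?thesis
    by (simp add: f.G.group_exponent_commutator_subgroup f.H.group_exponent_commutator_subgroup
        image_image)
qed

lemma (in group) nat_copy_derived_ord:
  assumes "finite (carrier G)" "g \<in> derived G (carrier G)"
  obtains Q :: "nat monoid" and g'
  where "group Q" "order Q = order G" "g' \<in> derived Q (carrier Q)" "group.ord Q g' = ord g"
proof -
  obtain Q :: "nat monoid" and f where Q: "group Q" and f: "f \<in> iso G Q"
    by (rule finite_group_iso_nat[OF is_group assms(1)])
  interpret f: group_hom G Q f
    using f Q by (simp add: group_hom_def group_hom_axioms_def iso_def is_group)
  have bij: "bij_betw f (carrier G) (carrier Q)"
    using f by (simp add: iso_def)
  have "f g \<in> derived Q (carrier Q)"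
    using f.derived_image[OF _ assms(2)] bij by (simp add: bij_betw_def)
  moreover have "g \<in> carrier G"
    using assms(2) derived_in_carrier[of "carrier G"] by blast
  ultimately show ?thesis
    using that[OF Q] bij_betw_same_card[OF bij] iso_ord[OF is_group Q f] by (simp add: order_def)
qed

context group begin

lemma exponent_commutator_subgroup_cyclic:
  assumes "cyclic_group G"
  shows "group_exponent (commutator_subgroup G) = 1"
proof -
  interpret comm_group G
    using assms by (rule cyclic_imp_abelian_group)
  show ?thesis
    using derived_eq_singleton[of "carrier G"] by (simp add: group_exponent_commutator_subgroup)
qed

lemma p_group_exponent_commutator_subgroup_le:
  assumes p: "prime p" and G: "order G = p ^ n" "n \<ge> 2"
  shows "group_exponent (commutator_subgroup G) * p\<^sup>2 \<le> order G"
proof -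
  note fin = p_group_finite[OF p G(1)]
  obtain g where g: "g \<in> derived G (carrier G)" "group_exponent (commutator_subgroup G) = ord g"
    using group_exponent_commutator_subgroup_attained[OF fin] .
  obtain Q :: "nat monoid" and g' where "group Q" "order Q = order G" "g' \<in> derived Q (carrier Q)"
    "group.ord Q g' = ord g"
    using nat_copy_derived_ord[OF fin g(1)] .
  moreover obtain j where "n = j + 2"
    using G(2) nat_le_iff_add by (metis add.commute)
  ultimately show ?thesis
    using nat_p_group_derived_ord_le[OF p, of Q j g'] G(1) g(2) by metis
qed

lemma odd_p_group_exponent_commutator_subgroup_square_less:
  assumes p: "prime p" "odd p" and G: "order G = p ^ n" "n > 0"
  shows "(group_exponent (commutator_subgroup G))\<^sup>2 < order G"
proof -
  note fin = p_group_finite[OF p(1) G(1)]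
  obtain g where g: "g \<in> derived G (carrier G)" "group_exponent (commutator_subgroup G) = ord g"
    using group_exponent_commutator_subgroup_attained[OF fin] .
  obtain Q :: "nat monoid" and g' where "group Q" "order Q = order G" "g' \<in> derived Q (carrier Q)"
    "group.ord Q g' = ord g"
    using nat_copy_derived_ord[OF fin g(1)] .
  then show ?thesis
    using nat_odd_p_group_derived_ord_square_less[OF p, of Q n g'] G g(2) by simp
qed

lemma order_le_prime_cyclic:
  assumes p: "prime p" and G: "order G = p ^ n" "order G \<le> p"
  shows "cyclic_group G"
proof -
  have "p ^ n \<le> p ^ 1"
    using G by simp
  then have "n \<le> 1"
    using power_le_imp_le_exp[OF prime_gt_1_nat[OF p]] by blast
  then consider "n = 0" | "n = 1"
    by linarith
  then show ?thesis
  proof cases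
    case 1
    then show ?thesis
      using cyclic_group_of_ord_eq_order[OF one_closed] p_group_finite[OF p G(1)] G(1) by simp
  next
    case 2
    then show ?thesis
      using prime_order_cyclic[OF p] G(1) by simp
  qed
qed

end

section \<open>Split metacyclic groups\<close>

text \<open>The semidirect product of \<open>\<int>/m\<close> and \<open>\<int>/l\<close> in which the generator of \<open>\<int>/l\<close> acts on \<open>\<int>/m\<close> as
  multiplication by \<open>u\<close>; for this to be a group, \<open>u ^ l\<close> has to be \<open>1\<close> modulo \<open>m\<close>.\<close>

definition split_metacyclic_group :: "nat \<Rightarrow> nat \<Rightarrow> nat \<Rightarrow> (nat \<times> nat) monoid" where
  "split_metacyclic_group m l u =
     \<lparr>carrier = {..<m} \<times> {..<l},
      monoid.mult = (\<lambda>(a, i) (b, j). ((a + u ^ i * b) mod m, (i + j) mod l)),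
      one = (0, 0)\<rparr>"

lemma power_mod_exponent:
  fixes u :: nat
  assumes "u ^ l mod m = 1 mod m"
  shows "u ^ (i mod l) mod m = u ^ i mod m"
proof -
  have "(u ^ l) ^ (i div l) mod m = 1 mod m"
    using power_mod[of "u ^ l" m "i div l"] power_mod[of 1 m "i div l"] assms by simp
  then have "u ^ (i mod l) * (u ^ l) ^ (i div l) mod m = u ^ (i mod l) * 1 mod m"
    by (rule mod_mult_cong[OF refl])
  then show ?thesis
    by (simp add: power_mult[symmetric] power_add[symmetric])
qed

locale split_metacyclic =
  fixes m l u :: nat
  assumes m: "m > 0" and l: "l > 0" and unit: "u ^ l mod m = 1 mod m"
begin

lemma action_mod_exponent: "(a + u ^ (i mod l) * b) mod m = (a + u ^ i * b) mod m"
  by (intro mod_add_cong mod_mult_cong power_mod_exponent unit refl)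

abbreviation "M \<equiv> split_metacyclic_group m l u"

lemma mult: "(a, i) \<otimes>\<^bsub>M\<^esub> (b, j) = ((a + u ^ i * b) mod m, (i + j) mod l)"
  and one: "\<one>\<^bsub>M\<^esub> = (0, 0)"
  and carrier: "carrier M = {..<m} \<times> {..<l}"
  by (simp_all add: split_metacyclic_group_def)

lemma group_M: "group M"
proof (rule groupI)
  fix x y z
  assume "x \<in> carrier M" "y \<in> carrier M" "z \<in> carrier M"
  obtain a i b j c k where x: "x = (a, i)" "y = (b, j)" "z = (c, k)"
    by (metis prod.exhaust)
  have "((a + u ^ i * b) mod m + u ^ ((i + j) mod l) * c) mod m =
      (a + u ^ i * (b + u ^ j * c)) mod m"
    unfolding action_mod_exponent mod_add_left_eq by (simp add: algebra_simps power_add)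
  also have "\<dots> = (a + u ^ i * ((b + u ^ j * c) mod m)) mod m"
    by (intro mod_add_cong mod_mult_cong refl) simp
  finally show "x \<otimes>\<^bsub>M\<^esub> y \<otimes>\<^bsub>M\<^esub> z = x \<otimes>\<^bsub>M\<^esub> (y \<otimes>\<^bsub>M\<^esub> z)"
    by (simp add: x mult mod_simps add.assoc)
next
  fix x assume "x \<in> carrier M"
  then obtain a i where x: "x = (a, i)" "a < m" "i < l"
    by (auto simp: carrier)
  let ?y = "((u ^ (l - i) * (m - a)) mod m, (l - i) mod l)"
  have "((u ^ (l - i) * (m - a)) mod m + u ^ ((l - i) mod l) * a) mod m =
      (u ^ (l - i) * ((m - a) + a)) mod m"
    unfolding action_mod_exponent distrib_left by (simp add: mod_simps)
  also have "\<dots> = 0"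
    using x by simp
  finally have "?y \<otimes>\<^bsub>M\<^esub> x = \<one>\<^bsub>M\<^esub>"
    using x by (simp add: mult one mod_simps)
  moreover have "?y \<in> carrier M"
    using m l by (simp add: carrier)
  ultimately show "\<exists>y\<in>carrier M. y \<otimes>\<^bsub>M\<^esub> x = \<one>\<^bsub>M\<^esub>"
    by blast
qed (use m l in \<open>auto simp: carrier mult one\<close>)

sublocale group M by (rule group_M)

lemma order_M: "order M = m * l"
  by (simp add: order_def carrier card_cartesian_product)

text \<open>The residues \<open>1 mod m\<close> and \<open>1 mod l\<close>, rather than \<open>1\<close>, also cover the case of a trivial factor.\<close>

definition gen_fst :: "nat \<times> nat" where "gen_fst = (1 mod m, 0)"
definition gen_snd :: "nat \<times> nat" where "gen_snd = (0, 1 mod l)"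

lemma gen_closed: "gen_fst \<in> carrier M" "gen_snd \<in> carrier M"
  using m l by (simp_all add: carrier gen_fst_def gen_snd_def)

lemma pow_fst: "a < m \<Longrightarrow> (a, 0) [^]\<^bsub>M\<^esub> (t::nat) = (t * a mod m, 0)"
  by (induction t) (simp_all add: one mult mod_simps add.commute)

lemma pow_gen_fst: "gen_fst [^]\<^bsub>M\<^esub> (t::nat) = (t mod m, 0)"
  using pow_fst[of "1 mod m" t] m by (simp add: gen_fst_def mod_mult_right_eq del: One_nat_def)

lemma pow_gen_snd: "gen_snd [^]\<^bsub>M\<^esub> (t::nat) = (0, t mod l)"
proof (induction t)
  case (Suc t)
  then show ?case
    unfolding nat_pow_Suc Suc by (simp add: gen_snd_def mult mod_add_eq del: One_nat_def) simp
qed (simp add: one)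

lemma generators: "generate M {gen_fst, gen_snd} = carrier M"
proof
  let ?S = "{gen_fst, gen_snd}"
  have S: "?S \<subseteq> carrier M"
    using gen_closed by simp
  then show "generate M ?S \<subseteq> carrier M"
    by (rule generate_incl)
  have sg: "subgroup (generate M ?S) M"
    by (rule generate_is_subgroup[OF S])
  have pow: "x [^]\<^bsub>M\<^esub> (t::nat) \<in> generate M ?S" if "x \<in> generate M ?S" for x t
    using that subgroup.m_closed[OF sg] subgroup.one_closed[OF sg] by (induction t) auto
  show "carrier M \<subseteq> generate M ?S"
  proof
    fix x assume "x \<in> carrier M"
    then obtain a i where x: "x = (a, i)" "a < m" "i < l"
      by (auto simp: carrier)
    have "gen_fst [^]\<^bsub>M\<^esub> a \<otimes>\<^bsub>M\<^esub> gen_snd [^]\<^bsub>M\<^esub> i \<in> generate M ?S"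
      by (intro subgroup.m_closed[OF sg] pow generate.incl) auto
    moreover have "gen_fst [^]\<^bsub>M\<^esub> a \<otimes>\<^bsub>M\<^esub> gen_snd [^]\<^bsub>M\<^esub> i = x"
      using x by (simp add: pow_gen_fst pow_gen_snd mult)
    ultimately show "x \<in> generate M ?S"
      by simp
  qed
qed

text \<open>The identity \<open>y x [x, y] = x y\<close> shows that \<open>[x, y] = (c, 0)\<close> with \<open>u * c\<close> congruent to \<open>1 - u\<close>
  modulo \<open>m\<close>. As \<open>u\<close> is a unit modulo \<open>m\<close>, a multiple of \<open>c\<close> vanishes exactly if the same multiple
  of \<open>u - 1\<close> does. The second hypothesis says that the greatest common divisor of \<open>m\<close> and \<open>u - 1\<close>
  is \<open>m div d\<close>.\<close>

lemma ord_commutator_generators: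
  assumes u: "u > 0" and d: "\<And>t. m dvd t * (u - 1) \<longleftrightarrow> d dvd t"
  shows "ord (commutator M gen_fst gen_snd) = d"
proof -
  note xy = gen_closed
  then have "commutator M gen_fst gen_snd \<in> carrier M"
    by (simp add: commutator_def)
  then obtain c e where ce: "commutator M gen_fst gen_snd = (c, e)" "c < m" "e < l"
    by (auto simp: carrier)
  have "gen_snd \<otimes>\<^bsub>M\<^esub> gen_fst \<otimes>\<^bsub>M\<^esub> commutator M gen_fst gen_snd = gen_fst \<otimes>\<^bsub>M\<^esub> gen_snd"
  proof -
    have [simp]: "v \<otimes>\<^bsub>M\<^esub> (inv\<^bsub>M\<^esub> v \<otimes>\<^bsub>M\<^esub> w) = w" if "v \<in> carrier M" "w \<in> carrier M" for v w
      using that by (simp add: m_assoc[symmetric])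
    show ?thesis
      using xy by (simp add: commutator_def m_assoc)
  qed
  moreover have "gen_snd \<otimes>\<^bsub>M\<^esub> gen_fst = (u mod m, 1 mod l)"
  proof -
    have "gen_snd \<otimes>\<^bsub>M\<^esub> gen_fst = ((0 + u ^ (1 mod l) * 1) mod m, 1 mod l)"
      by (simp add: gen_fst_def gen_snd_def mult mod_mult_right_eq del: One_nat_def)
    then show ?thesis
      unfolding action_mod_exponent by simp
  qed
  moreover have "gen_fst \<otimes>\<^bsub>M\<^esub> gen_snd = (1 mod m, 1 mod l)"
    by (simp add: gen_fst_def gen_snd_def mult del: One_nat_def)
  ultimately have "(u mod m + u ^ (1 mod l) * c) mod m = 1 mod m" and e: "(1 mod l + e) mod l = 1 mod l"
    by (simp_all add: ce mult del: One_nat_def)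
  then have uc: "(u + u * c) mod m = 1 mod m"
    unfolding action_mod_exponent by (simp add: mod_simps)
  have "e = 0"
  proof -
    have "(1 + e) mod l = (1 + 0) mod l"
      using e by (simp add: mod_add_left_eq del: One_nat_def)
    then have "l dvd e"
      using mod_eq_dvd_iff_nat[of 1 "1 + e" l] by simp
    then show ?thesis
      using ce(3) by (auto dest: dvd_imp_le)
  qed
  have "m dvd u + u * c - 1"
    using uc u mod_eq_dvd_iff_nat[of 1 "u + u * c" m] by simp
  then have mu: "m dvd u * c + (u - 1)"
    using u by (simp add: add.commute)
  have cop: "coprime m u"
  proof (rule coprimeI)
    fix q assume q: "q dvd m" "q dvd u"
    then have "q dvd u ^ l"
      using l dvd_trans[OF _ dvd_power] by blast
    then show "is_unit q"
      using unit q(1) dvd_mod_iff[of q m "u ^ l"] dvd_mod_iff[of q m 1] by simp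
  qed
  have "(c, 0) [^]\<^bsub>M\<^esub> t = \<one>\<^bsub>M\<^esub> \<longleftrightarrow> d dvd t" for t :: nat
  proof -
    have "(c, 0) [^]\<^bsub>M\<^esub> t = \<one>\<^bsub>M\<^esub> \<longleftrightarrow> m dvd t * c"
      using ce(2) by (simp add: pow_fst one mod_eq_0_iff_dvd)
    also have "\<dots> \<longleftrightarrow> m dvd u * (t * c)"
      using cop by (simp add: coprime_dvd_mult_right_iff)
    also have "\<dots> \<longleftrightarrow> m dvd t * (u - 1)"
    proof -
      have "m dvd t * (u * c + (u - 1))"
        using mu by simp
      also have "t * (u * c + (u - 1)) = u * (t * c) + t * (u - 1)"
        by (simp only: distrib_left mult_ac)
      finally show ?thesis
        using dvd_add_right_iff dvd_add_left_iff by blast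
    qed
    finally show ?thesis
      using d by simp
  qed
  moreover have "(c, 0) \<in> carrier M"
    using ce l by (simp add: carrier)
  ultimately show ?thesis
    using ord_unique[of "(c, 0)" d] ce(1) \<open>e = 0\<close> by simp
qed

text \<open>Since \<open>u\<close> is \<open>1\<close> modulo \<open>q\<close>, reducing the first component modulo \<open>q\<close> is a homomorphism to the direct
  product of \<open>\<int>/q\<close> and \<open>\<int>/l\<close>. It kills the commutator subgroup, which thus consists of elements
  \<open>(a, 0)\<close> with \<open>q\<close> dividing \<open>a\<close>.\<close>

lemma derived_pow_eq_one:
  assumes q: "m = q * d" "u mod q = 1 mod q" and x: "x \<in> derived M (carrier M)"
  shows "x [^]\<^bsub>M\<^esub> d = \<one>\<^bsub>M\<^esub>"
proof -
  have "q > 0"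
    using q(1) m by (cases q) auto
  \<comment> \<open>The trivial action: \<open>A.M\<close> is the direct product.\<close>
  interpret A: split_metacyclic q l 1
    using \<open>q > 0\<close> l by unfold_locales auto
  have A_comm: "comm_group A.M"
  proof (rule A.group_comm_groupI)
    fix x y assume "x \<in> carrier A.M" "y \<in> carrier A.M"
    show "x \<otimes>\<^bsub>A.M\<^esub> y = y \<otimes>\<^bsub>A.M\<^esub> x"
      by (cases x; cases y) (simp add: A.mult add.commute del: One_nat_def)
  qed
  define h where "h = (\<lambda>(a, i). (a mod q, i :: nat))"
  have upow: "u ^ i mod q = 1 mod q" for i
    using power_mod[of u q i] power_mod[of 1 q i] q(2) by simp
  have *: "(a + u ^ i * b) mod m mod q = (a mod q + 1 ^ i * (b mod q)) mod q" for a b i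
  proof -
    have "(a + u ^ i * b) mod m mod q = (a + u ^ i * b) mod q"
      using q(1) by (simp add: mod_mod_cancel)
    also have "\<dots> = (a + 1 * b) mod q"
      by (intro mod_add_cong mod_mult_cong upow refl)
    finally show ?thesis
      by (simp add: mod_simps)
  qed
  have "h \<in> hom M A.M"
    using \<open>q > 0\<close> by (auto simp: hom_def h_def carrier mult A.carrier A.mult * simp del: One_nat_def power_one)
  then interpret h: group_hom M A.M h
    by (simp add: group_hom_def group_hom_axioms_def group_axioms A.group_axioms del: One_nat_def)
  have xM: "x \<in> carrier M"
    using x derived_in_carrier[of "carrier M"] by blast
  have "h x \<in> derived A.M (h ` carrier M)"
    using h.derived_img[of "carrier M"] x by blast
  also have "\<dots> = {\<one>\<^bsub>A.M\<^esub>}"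
    using h.hom_closed by (intro comm_group.derived_eq_singleton[OF A_comm]) blast
  finally have "h x = (0, 0)"
    by (simp add: A.one del: One_nat_def)
  then obtain a where a: "x = (a, 0)" "q dvd a" "a < m"
    using xM by (cases x) (auto simp: h_def carrier mod_eq_0_iff_dvd)
  then have "m dvd d * a"
    using q(1) by (auto simp: mult_ac)
  then show ?thesis
    using a by (simp add: pow_fst one mod_eq_0_iff_dvd)
qed

end

lemma (in split_metacyclic) nat_group_with_commutator_exponent:
  assumes "u > 0" "\<And>t. m dvd t * (u - 1) \<longleftrightarrow> d dvd t" "m = q * d" "u mod q = 1 mod q"
  shows "\<exists>(G :: nat monoid) x y. group G \<and> order G = m * l \<and>
           x \<in> carrier G \<and> y \<in> carrier G \<and> generate G {x, y} = carrier G \<and>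
           group.ord G (commutator G x y) = group_exponent (commutator_subgroup G) \<and>
           group_exponent (commutator_subgroup G) = d"
proof -
  have fin: "finite (carrier M)"
    by (simp add: carrier)
  obtain G :: "nat monoid" and f where G: "group G" and f: "f \<in> iso M G"
    by (rule finite_group_iso_nat[OF is_group fin])
  interpret f: group_hom M G f
    using f G by (simp add: group_hom_def group_hom_axioms_def iso_def is_group)
  have surj: "f ` carrier M = carrier G"
    using f by (simp add: iso_def bij_betw_def)
  note xy = gen_closed
  have c: "commutator M gen_fst gen_snd \<in> derived M (carrier M)"
    unfolding derived_eq_generate_commutators using xy by (blast intro: generate.incl)
  have ord_c: "ord (commutator M gen_fst gen_snd) = d"
    by (rule ord_commutator_generators[OF assms(1,2)])
  have "d > 0"
    using assms(3) m by (cases d) auto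
  have "Max (ord ` derived M (carrier M)) = d"
  proof (rule Max_eqI)
    show "finite (ord ` derived M (carrier M))"
      using fin derived_in_carrier[of "carrier M"] finite_subset by blast
    show "d \<in> ord ` derived M (carrier M)"
      using c ord_c by blast
    fix n assume "n \<in> ord ` derived M (carrier M)"
    then obtain g where g: "n = ord g" "g \<in> derived M (carrier M)"
      by blast
    then have "ord g dvd d"
      using pow_eq_id derived_pow_eq_one[OF assms(3,4)] derived_in_carrier[of "carrier M"] by blast
    then show "n \<le> d"
      using g(1) \<open>d > 0\<close> dvd_imp_le by simp
  qed
  then have exp: "group_exponent (commutator_subgroup G) = d"
    using iso_group_exponent_commutator_subgroup[OF is_group G f] group_exponent_commutator_subgroup
    by simp
  show ?thesis
  proof (intro exI conjI)
    show "order G = m * l"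
      using order_M is_isoI[OF f] iso_same_card unfolding order_def by metis
    show "generate G {f gen_fst, f gen_snd} = carrier G"
      using f.generate_img[of "{gen_fst, gen_snd}"] xy generators surj by simp
    have "commutator G (f gen_fst) (f gen_snd) = f (commutator M gen_fst gen_snd)"
      using xy by (simp add: commutator_def)
    then show "group.ord G (commutator G (f gen_fst) (f gen_snd)) = group_exponent (commutator_subgroup G)"
      using iso_ord[OF is_group G f, of "commutator M gen_fst gen_snd"] c
        derived_in_carrier[of "carrier M"] ord_c exp by auto
  qed (use xy G exp in auto)
qed

section \<open>Groups attaining the bounds\<close>

lemma power_mod_eq_one_if_int_dvd:
  assumes "int m dvd int u ^ l - 1"
  shows "u ^ l mod m = 1 mod m"
proof -
  have "int (u ^ l) mod int m = int 1 mod int m"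
    using assms by (simp add: mod_eq_dvd_iff)
  then show ?thesis
    by (metis of_nat_eq_iff of_nat_mod)
qed

text \<open>Raising \<open>a = (1 + p) ^ (p ^ e)\<close> to the \<open>p\<close>-th power multiplies \<open>a - 1\<close> by the sum of the \<open>a ^ i\<close> with
  \<open>i < p\<close>; each summand is \<open>1\<close> modulo \<open>p\<close>, so that the sum is divisible by \<open>p\<close>.\<close>

lemma prime_power_dvd_one_plus_power:
  "int p ^ Suc e dvd (1 + int p) ^ (p ^ e) - 1"
proof (induction e)
  case (Suc e)
  define a where "a = (1 + int p) ^ (p ^ e)"
  have IH: "int p ^ Suc e dvd a - 1"
    using Suc by (simp add: a_def)
  have "int p dvd a - 1"
    using IH by (rule dvd_trans[rotated]) simp
  moreover have "a - 1 dvd a ^ i - 1" for i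
    using power_diff_1_eq[of a i] by simp
  ultimately have "int p dvd (\<Sum>i<p. a ^ i - 1)"
    by (intro dvd_sum) (blast intro: dvd_trans)
  then have "int p dvd (\<Sum>i<p. a ^ i - 1) + int p"
    by simp
  also have "(\<Sum>i<p. a ^ i - 1) + int p = (\<Sum>i<p. a ^ i)"
    by (simp add: sum_subtractf)
  finally have "int p ^ Suc e * int p dvd (a - 1) * (\<Sum>i<p. a ^ i)"
    using IH by (rule mult_dvd_mono[rotated])
  also have "(a - 1) * (\<Sum>i<p. a ^ i) = a ^ p - 1"
    by (rule power_diff_1_eq[symmetric])
  also have "a ^ p = (1 + int p) ^ (p ^ Suc e)"
    by (simp add: a_def power_mult[symmetric] mult.commute)
  finally show ?case
    by (simp add: mult.commute)
qed simp

lemma split_metacyclic_p_group: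
  assumes p: "prime p" and n: "n = Suc k + e"
    and u: "u > 0" "u mod p = 1 mod p" "u ^ (p ^ e) mod p ^ Suc k = 1 mod p ^ Suc k"
    and div: "\<And>t. p ^ Suc k dvd t * (u - 1) \<longleftrightarrow> p ^ k dvd t"
  shows "\<exists>(G :: nat monoid) x y. finite_p_group p G \<and> order G = p ^ n \<and>
           x \<in> carrier G \<and> y \<in> carrier G \<and> generate G {x, y} = carrier G \<and>
           group.ord G (commutator G x y) = group_exponent (commutator_subgroup G) \<and>
           group_exponent (commutator_subgroup G) = p ^ k"
proof -
  interpret split_metacyclic "p ^ Suc k" "p ^ e" u
    using prime_gt_0_nat[OF p] u(3) by unfold_locales auto
  obtain G :: "nat monoid" and x y where G: "group G" "order G = p ^ Suc k * p ^ e"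
      and xy: "x \<in> carrier G" "y \<in> carrier G" "generate G {x, y} = carrier G"
        "group.ord G (commutator G x y) = group_exponent (commutator_subgroup G)"
        "group_exponent (commutator_subgroup G) = p ^ k"
    using nat_group_with_commutator_exponent[OF u(1) div power_Suc u(2)] by blast
  moreover have "order G = p ^ n"
    by (simp add: G(2) n power_add)
  ultimately show ?thesis
    unfolding finite_p_group_def by blast
qed

text \<open>The cyclic group of order \<open>2 ^ (k + 1)\<close> is extended by one of order \<open>2 ^ (n - k - 1)\<close> acting by
  inversion, so that the commutator of the generators is, up to sign, twice a generator of the
  first group. Inversion has order at most \<open>2\<close>, and \<open>k \<le> n - 2\<close> makes the order of the acting
  group even.\<close>

lemma two_group_with_commutator_exponent:
  fixes n k :: nat
  assumes "2 \<le> n" "k \<le> n - 2"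
  shows "\<exists>(G :: nat monoid) x y. finite_p_group 2 G \<and> order G = 2 ^ n \<and>
           x \<in> carrier G \<and> y \<in> carrier G \<and> generate G {x, y} = carrier G \<and>
           group.ord G (commutator G x y) = group_exponent (commutator_subgroup G) \<and>
           group_exponent (commutator_subgroup G) = 2 ^ k"
proof (rule split_metacyclic_p_group)
  show "n = Suc k + (n - Suc k)"
    using assms by simp
  let ?u = "2 ^ Suc k - 1 :: nat"
  have "(1::nat) < 2 ^ Suc k"
    by (rule one_less_power) auto
  then show "?u > 0"
    by simp
  show "?u mod 2 = 1 mod 2"
    by (simp add: mod_2_eq_odd)
  obtain j where j: "2 ^ (n - Suc k) = 2 * (j::nat)"
    using assms by (cases "n - Suc k") auto
  have int_u: "int ?u = 2 ^ Suc k - 1"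
    by (simp add: of_nat_diff)
  have "int (2 ^ Suc k) dvd int ?u ^ 2 - 1"
    unfolding int_u by (simp add: power2_eq_square algebra_simps)
  also have "int ?u ^ 2 - 1 dvd (int ?u ^ 2) ^ j - 1"
    using power_diff_1_eq[of "int ?u ^ 2" j] by simp
  finally show "?u ^ 2 ^ (n - Suc k) mod 2 ^ Suc k = 1 mod 2 ^ Suc k"
    unfolding j power_mult by (intro power_mod_eq_one_if_int_dvd) simp
  show "2 ^ Suc k dvd t * (?u - 1) \<longleftrightarrow> 2 ^ k dvd t" for t :: nat
  proof (cases k)
    case (Suc i)
    have "?u - 1 = 2 * (2 ^ k - 1)"
      by (simp add: diff_mult_distrib2)
    then have "t * (?u - 1) = 2 * (t * (2 ^ k - 1))"
      by (simp only: mult_ac)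
    then have "2 ^ Suc k dvd t * (?u - 1) \<longleftrightarrow> (2::nat) ^ k dvd t * (2 ^ k - 1)"
      by (simp only: power_Suc nat_mult_dvd_cancel_disj) simp
    moreover have "coprime (2 ^ k) (2 ^ k - 1 :: nat)"
      by (rule coprime_diff_one_right_nat) simp
    ultimately show ?thesis
      by (simp add: coprime_dvd_mult_left_iff)
  qed simp
qed simp

text \<open>The cyclic group of order \<open>p ^ (k + 1)\<close> is extended by one of order \<open>p ^ (n - k - 1)\<close> acting as
  multiplication by \<open>1 + p\<close>. The order of this unit modulo \<open>p ^ (k + 1)\<close> divides \<open>p ^ k\<close>, and
  \<open>k \<le> n - k - 1\<close>.\<close>

lemma p_group_with_commutator_exponent:
  fixes p n k :: nat
  assumes p: "prime p" and k: "2 * k < n"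
  shows "\<exists>(G :: nat monoid) x y. finite_p_group p G \<and> order G = p ^ n \<and>
           x \<in> carrier G \<and> y \<in> carrier G \<and> generate G {x, y} = carrier G \<and>
           group.ord G (commutator G x y) = group_exponent (commutator_subgroup G) \<and>
           group_exponent (commutator_subgroup G) = p ^ k"
proof (rule split_metacyclic_p_group[OF p])
  show "n = Suc k + (n - Suc k)"
    using k by simp
  show "1 + p > 0" "(1 + p) mod p = 1 mod p"
    by (simp, rule mod_add_self2)
  have "int (p ^ Suc k) dvd int p ^ Suc (n - Suc k)"
    using k unfolding of_nat_power by (intro le_imp_power_dvd) auto
  also have "\<dots> dvd int (1 + p) ^ p ^ (n - Suc k) - 1"
    using prime_power_dvd_one_plus_power by simp
  finally show "(1 + p) ^ p ^ (n - Suc k) mod p ^ Suc k = 1 mod p ^ Suc k"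
    by (rule power_mod_eq_one_if_int_dvd)
  show "p ^ Suc k dvd t * (1 + p - 1) \<longleftrightarrow> p ^ k dvd t" for t
    using prime_gt_0_nat[OF p] by simp
qed

section \<open>Upper bounds and their sharpness\<close>

theorem theorem3:
  shows
    "(\<forall>G :: ('a, 'b) monoid_scheme. finite_p_group 2 G \<longrightarrow>
        (if order G \<le> 2 then group_exponent (commutator_subgroup G) = 1
         else real (group_exponent (commutator_subgroup G)) \<le> real (order G) / 4))
   \<and> (\<forall>n k :: nat. 2 \<le> n \<and> k \<le> n - 2 \<longrightarrow>
        (\<exists>(G :: nat monoid) x y. finite_p_group 2 G \<and> order G = 2 ^ n \<and>
           x \<in> carrier G \<and> y \<in> carrier G \<and> generate G {x, y} = carrier G \<and>
           group.ord G (commutator G x y) = group_exponent (commutator_subgroup G) \<and>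
           group_exponent (commutator_subgroup G) = 2 ^ k))
   \<and> (\<forall>(p :: nat) (G :: ('a, 'b) monoid_scheme).
        prime p \<and> odd p \<and> finite_p_group p G \<and> order G \<noteq> 1 \<longrightarrow>
        (group_exponent (commutator_subgroup G))\<^sup>2 < order G)
   \<and> (\<forall>p n k :: nat. prime p \<and> odd p \<and> real k < real n / 2 \<longrightarrow>
        (\<exists>(G :: nat monoid) x y. finite_p_group p G \<and> order G = p ^ n \<and>
           x \<in> carrier G \<and> y \<in> carrier G \<and> generate G {x, y} = carrier G \<and>
           group.ord G (commutator G x y) = group_exponent (commutator_subgroup G) \<and>
           group_exponent (commutator_subgroup G) = p ^ k))"
proof (intro conjI allI impI)
  fix G :: "('a, 'b) monoid_scheme"
  assume "finite_p_group 2 G"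
  then obtain m where G: "group G" "order G = 2 ^ m"
    by (auto simp: finite_p_group_def)
  interpret group G by (rule G(1))
  show "if order G \<le> 2 then group_exponent (commutator_subgroup G) = 1
        else real (group_exponent (commutator_subgroup G)) \<le> real (order G) / 4"
  proof (cases "order G \<le> 2")
    case True
    then show ?thesis
      using exponent_commutator_subgroup_cyclic order_le_prime_cyclic[OF two_is_prime_nat G(2)]
      by simp
  next
    case False
    then have "m \<noteq> 0" "m \<noteq> 1"
      using G(2) by (intro notI; simp)+
    then have "group_exponent (commutator_subgroup G) * 4 \<le> order G"
      using p_group_exponent_commutator_subgroup_le[OF two_is_prime_nat G(2)] by simp
    then have "real (group_exponent (commutator_subgroup G)) * 4 \<le> real (order G)"
      by (metis of_nat_le_iff of_nat_mult of_nat_numeral)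
    then show ?thesis
      using False by simp
  qed
next
  fix p :: nat and G :: "('a, 'b) monoid_scheme"
  assume *: "prime p \<and> odd p \<and> finite_p_group p G \<and> order G \<noteq> 1"
  then obtain m where G: "group G" "order G = p ^ m" "m > 0"
    by (auto simp: finite_p_group_def intro: gr0I)
  then show "(group_exponent (commutator_subgroup G))\<^sup>2 < order G"
    using group.odd_p_group_exponent_commutator_subgroup_square_less * by blast
qed (use two_group_with_commutator_exponent p_group_with_commutator_exponent in auto)

end
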